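(* Fix a real number $r\ge1$. For every finite simple graph $G=(V,E)$ whose neighborhoods are fractionally $r$-colorable and every positive weight function $w\in\mathbb R_{>0}^V$, there is a probability distribution $\mu$ on $\mathcal I(G)$ such that, for all $v\in V$, $$\mu(v)\ge f(K(r)\,d_w(v)).$$
   Context: All graphs are finite and simple; $\log$ is the natural logarithm. $N(v)$ is the set of neighbors of $v$. $\mathcal I(G)$ is the set of independent sets of $G$, including $\emptyset$. For a distribution $\mu$ on $\mathcal I(G)$, $\mu(v)=\mathbb P_{\mathbf I\sim\mu}(v\in\mathbf I)$. For positive weights $w$ and $S\subseteq V$ write $w(S)=\sum_{x\in S}w(x)$; the weighted degree is $d_w(v)=w(N(v))/w(v)$. The neighborhoods of $G$ are fractionally $r$-colorable if for each $v\in V$ there is a probability distribution on $\mathcal I(G[N(v)])$ under which every vertex of $N(v)$ belongs to the random independent set with probability exactly $1/r$. For $r\ge1$, $K(r)$ is the unique $K\ge1$ satisfying $K-1=\log(rK)$. The function $f:[0,\infty)\to(0,1]$ is Shearer's function $$f(x)=\frac{x\log x-x+1}{(x-1)^2},$$ with continuous values $f(0)=1$ and $f(1)=1/2$. *)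

theory Defs
  imports "HOL-Probability.Probability_Mass_Function" "HOL-Library.Ramsey"
begin

text \<open>A graph is given by its vertex set and its set of edges, each edge being a two-element
  set of vertices.\<close>

definition finite_simple_graph :: "'a set \<Rightarrow> 'a set set \<Rightarrow> bool" where
  "finite_simple_graph V E \<longleftrightarrow> finite V \<and> E \<subseteq> [V]\<^bsup>2\<^esup>"

definition neighbors :: "'a set set \<Rightarrow> 'a \<Rightarrow> 'a set" where
  "neighbors E v = {u. {v, u} \<in> E}"

definition induced_edges :: "'a set set \<Rightarrow> 'a set \<Rightarrow> 'a set set" where
  "induced_edges E S = {e \<in> E. e \<subseteq> S}"

definition independent_sets :: "'a set \<Rightarrow> 'a set set \<Rightarrow> 'a set set" where
  "independent_sets V E = {I. I \<subseteq> V \<and> indep I E}"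

text \<open>A distribution on independent sets is a probability mass function supported on
  \<^const>\<open>independent_sets\<close>; this is the probability that its sample contains \<open>v\<close>.\<close>

definition occupancy :: "'a set pmf \<Rightarrow> 'a \<Rightarrow> real" where
  "occupancy \<mu> v = measure_pmf.prob \<mu> {I. v \<in> I}"

definition neighborhoods_fractionally_colorable ::
    "real \<Rightarrow> 'a set \<Rightarrow> 'a set set \<Rightarrow> bool" where
  "neighborhoods_fractionally_colorable r V E \<longleftrightarrow>
     (\<forall>v\<in>V. \<exists>\<nu> :: 'a set pmf.
        set_pmf \<nu> \<subseteq> independent_sets (neighbors E v) (induced_edges E (neighbors E v)) \<and>
        (\<forall>u\<in>neighbors E v. occupancy \<nu> u = 1 / r))"

definition weighted_degree :: "'a set set \<Rightarrow> ('a \<Rightarrow> real) \<Rightarrow> 'a \<Rightarrow> real" where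
  "weighted_degree E w v = sum w (neighbors E v) / w v"

definition K_const :: "real \<Rightarrow> real" where
  "K_const r = (THE K. K \<ge> 1 \<and> K - 1 = ln (r * K))"

text \<open>For \<open>r \<ge> 1\<close> the description above is proper.\<close>

lemma K_const_ex1:
  fixes r :: real
  assumes r: "r \<ge> 1"
  shows "\<exists>!K. K \<ge> 1 \<and> K - 1 = ln (r * K)"
proof -
  have ex: "\<exists>K. 1 \<le> K \<and> K \<le> 4 * r \<and> K - 1 - ln (r * K) = 0"
  proof (rule IVT')
    show "1 - 1 - ln (r * 1) \<le> 0" using r by simp
    have "ln (r * (4 * r)) = ln ((2 * r) ^ 2)"
      by (simp add: power2_eq_square mult_ac)
    also have "\<dots> = 2 * ln (2 * r)"
      using r by (subst ln_realpow) auto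
    also have "\<dots> \<le> 2 * (2 * r - 1)"
      using r by (intro mult_left_mono ln_le_minus_one) auto
    finally show "0 \<le> 4 * r - 1 - ln (r * (4 * r))" using r by simp
    show "1 \<le> 4 * r" using r by simp
    show "continuous_on {1..4 * r} (\<lambda>K. K - 1 - ln (r * K))"
      using r by (intro continuous_intros) auto
  qed
  have less: "a - 1 - ln (r * a) < b - 1 - ln (r * b)" if "1 \<le> a" "a < b" for a b :: real
  proof -
    have "ln (b / a) < b / a - 1"
      using that ln_eq_minus_one[of "b / a"] ln_le_minus_one[of "b / a"] by force
    also have "\<dots> = (b - a) / a" using that by (simp add: field_simps)
    also have "\<dots> \<le> b - a"
      using that divide_left_mono[of 1 a "b - a"] by simp
    finally show ?thesis using that r by (simp add: ln_div ln_mult)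
  qed
  show ?thesis
  proof (rule ex_ex1I)
    show "\<exists>K. K \<ge> 1 \<and> K - 1 = ln (r * K)" using ex by auto
    show "a = b" if "a \<ge> 1 \<and> a - 1 = ln (r * a)" "b \<ge> 1 \<and> b - 1 = ln (r * b)" for a b
      using that less[of a b] less[of b a] by (cases a b rule: linorder_cases) auto
  qed
qed

definition shearer :: "real \<Rightarrow> real" where
  "shearer x = (if x = 0 then 1 else if x = 1 then 1 / 2
     else (x * ln x - x + 1) / (x - 1)\<^sup>2)"

end

theory Submission
  imports Defs
begin

text \<open>
  Write \<open>f\<close> for Shearer's function, \<open>N v\<close> for the neighbourhood of \<open>v\<close>, \<open>K\<close> for \<open>K_const r\<close>, and
  extend the demand \<open>u \<mapsto> f (K * d\<^sub>w(u))\<close> to weights that vanish on some vertices, where the demand is \<open>0\<close>.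
  Call a vector attainable if some distribution on independent sets dominates it. Attainable
  vectors form a closed convex set, so it suffices to write the demand of \<open>w\<close> as (at most) an average
  of demands of other weights that are easier to meet.

  The averaging step is local. Choose a vertex \<open>v\<close> with probability proportional to \<open>w v\<close> and change \<open>w\<close>
  only on \<open>N v\<close>, in one of two ways.
   \<^item> With probability \<open>1 - 1/K\<close>, set \<open>w\<close> to zero on \<open>N v\<close>. This commits to \<open>v\<close>, whose demand becomes \<open>1\<close>.
   \<^item> With probability \<open>1/K\<close>, sample an independent set \<open>S\<close> of \<open>N v\<close> from the fractional colouring,
     multiply \<open>w\<close> by \<open>r * K\<close> on \<open>S\<close>, and set it to zero on the rest of \<open>N v\<close>.
  The second option multiplies the expected weight of a vertex in \<open>N v\<close> by \<open>K\<close>, so over both options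
  the expected weight of every vertex in \<open>N v\<close> is unchanged. Hence, by convexity of \<open>f\<close>, a vertex outside
  \<open>N v\<close> loses nothing on average. A vertex \<open>u\<close> of \<open>N v\<close> survives only if the second option is taken and \<open>u\<close>
  lies in \<open>S\<close>; its other neighbours in \<open>N v\<close> have then disappeared, and its degree has dropped by a factor of at least \<open>r * K\<close>. The
  loss of \<open>u\<close> is controlled by the convexity of \<open>t * f t\<close> in \<open>ln t\<close>, at a price proportional to
  \<open>ln (r * K) = K - 1\<close>. The gain of \<open>u\<close> when \<open>v = u\<close> pays for this price exactly, and the identity behind
  that balance is Shearer's differential equation. This is \<open>demand_le_average\<close>.

  Iterating: the first option strictly shrinks the support of \<open>w\<close>, so by induction its demand is
  attainable, and the second option has only probability \<open>1/K\<close>. If all demands are attainable up to an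
  error \<open>\<delta>\<close>, they are therefore attainable up to \<open>\<delta> / K\<close>, hence, by closedness, exactly. This needs
  \<open>K > 1\<close>. To include \<open>r = 1\<close>, where \<open>K = 1\<close>, the theorem is obtained as a limit from slightly larger
  values of \<open>K\<close>, for which thinning the colourings supplies the corresponding larger \<open>r\<close>.
\<close>

section \<open>Convexity properties of Shearer's function\<close>

lemma denom_pos:
  fixes x s :: real
  assumes "0 < x" "0 \<le> s" "s \<le> 1"
  shows "0 < 1 - s + x * s"
proof (cases "s = 1")
  case False
  then show ?thesis using assms by (intro add_pos_nonneg) auto
qed (use assms in auto)

text \<open>The integral form makes both the convexity of Shearer's function and its smoothness at the
  removable singularity \<open>1\<close> evident.\<close>

lemma shearer_has_integral:
  fixes t :: real
  assumes t: "0 \<le> t"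
  shows "((\<lambda>s. (1 - s) / (1 - s + t * s)) has_integral shearer t) {0..1}"
proof (cases "t = 0 \<or> t = 1")
  case True
  then show ?thesis
  proof
    assume [simp]: "t = 0"
    have "((\<lambda>s::real. 1::real) has_integral 1) {0..1}"
      using has_integral_const_real[of "1::real" 0 1] by simp
    then have "((\<lambda>s::real. (1 - s) / (1 - s)) has_integral 1) {0..1}"
      by (rule has_integral_spike_finite[of "{1}", rotated 2]) auto
    then show ?thesis by (simp add: shearer_def)
  next
    assume [simp]: "t = 1"
    have "((\<lambda>s::real. 1 - s) has_integral (1 - 1 ^ 2 / 2) - (0 - 0 ^ 2 / 2)) {0..1}"
      by (rule fundamental_theorem_of_calculus)
        (auto intro!: derivative_eq_intros simp flip: has_real_derivative_iff_has_vector_derivative)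
    then show ?thesis by (simp add: shearer_def)
  qed
next
  case False
  then have t0: "0 < t" and t1: "t - 1 \<noteq> 0" using t by auto
  define c d where "c = - 1 / (t - 1)" and "d = t / (t - 1)\<^sup>2"
  let ?F = "\<lambda>s. c * s + d * ln (1 - s + t * s)"
  have "((\<lambda>s. (1 - s) / (1 - s + t * s)) has_integral ?F 1 - ?F 0) {0..1}"
  proof (rule fundamental_theorem_of_calculus)
    fix s :: real
    assume s: "s \<in> {0..1}"
    then have p: "0 < 1 - s + t * s" using denom_pos[OF t0, of s] by simp
    have "(?F has_real_derivative c + d * ((t - 1) / (1 - s + t * s))) (at s within {0..1})"
      using p by (auto intro!: derivative_eq_intros)
    also have "c + d * ((t - 1) / (1 - s + t * s)) = (1 - s) / (1 - s + t * s)"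
    proof -
      have "d * ((t - 1) / (1 - s + t * s)) = t / ((t - 1) * (1 - s + t * s))"
        using t1 p by (simp add: d_def power2_eq_square)
      moreover have "c = - (1 - s + t * s) / ((t - 1) * (1 - s + t * s))"
      proof -
        have "c = - P / ((t - 1) * P)" if "P \<noteq> 0" for P :: real
          using that by (simp add: c_def)
        then show ?thesis using p by (metis less_irrefl)
      qed
      moreover have "(1 - s) / (1 - s + t * s) = ((t - 1) * (1 - s)) / ((t - 1) * (1 - s + t * s))"
        using t1 p by simp
      moreover have "- (1 - s + t * s) + t = (t - 1) * (1 - s)" by algebra
      ultimately show ?thesis by (metis add_divide_distrib)
    qed
    finally show "(?F has_vector_derivative (1 - s) / (1 - s + t * s)) (at s within {0..1})"
      by (simp add: has_real_derivative_iff_has_vector_derivative)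
  qed simp
  moreover have "?F 1 - ?F 0 = shearer t"
  proof -
    have "- 1 / q = - q / q\<^sup>2" if "q \<noteq> 0" for q :: real
      using that by (simp add: power2_eq_square)
    then have "c = - (t - 1) / (t - 1)\<^sup>2" using t1 unfolding c_def by blast
    then show ?thesis
      using False by (simp add: shearer_def d_def add_divide_distrib diff_divide_distrib)
  qed
  ultimately show ?thesis by simp
qed

text \<open>This is the derivative of \<open>x * shearer x\<close>, see \<open>mult_shearer_deriv\<close>. Consequently
  \<open>shearer x - shearer_slope x\<close> equals \<open>- x * f' x\<close> for Shearer's function \<open>f\<close>.\<close>

definition shearer_slope :: "real \<Rightarrow> real" where
  "shearer_slope x = integral {0..1} (\<lambda>s. ((1 - s) / (1 - s + x * s))\<^sup>2)"

lemma shearer_slope_has_integral: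
  fixes x :: real
  assumes "0 < x"
  shows "((\<lambda>s. ((1 - s) / (1 - s + x * s))\<^sup>2) has_integral shearer_slope x) {0..1}"
  unfolding shearer_slope_def
  by (intro integrable_integral integrable_continuous_real continuous_intros)
    (use denom_pos[OF assms] in \<open>force\<close>)

text \<open>The two integrands differ by \<open>x\<close> times the derivative of \<open>s * (1 - s) / (1 - s + x * s)\<close>, which vanishes
  at both ends. Unlike the defining integrand times \<open>x\<close>, the new one is pointwise increasing
  in \<open>x\<close>.\<close>

lemma shearer_slope_times_has_integral:
  fixes x :: real
  assumes x: "0 < x"
  shows "((\<lambda>s. (x * s / (1 - s + x * s))\<^sup>2) has_integral x * shearer_slope x) {0..1}"
proof -
  let ?G = "\<lambda>s. s * (1 - s) / (1 - s + x * s)"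
  have "((\<lambda>s. ((1 - s)\<^sup>2 - x * s\<^sup>2) / (1 - s + x * s)\<^sup>2) has_integral ?G 1 - ?G 0) {0..1}"
  proof (rule fundamental_theorem_of_calculus)
    fix s :: real
    assume "s \<in> {0..1}"
    then have p: "1 - s + x * s \<noteq> 0" using denom_pos[OF x, of s] by simp
    have "(?G has_real_derivative
        ((1 * (1 - s) + (0 - 1) * s) * (1 - s + x * s) - s * (1 - s) * (0 - 1 + x * 1))
          / ((1 - s + x * s) * (1 - s + x * s))) (at s within {0..1})"
      using p by (intro derivative_intros) auto
    also have "(1 * (1 - s) + (0 - 1) * s) * (1 - s + x * s) - s * (1 - s) * (0 - 1 + x * 1)
        = (1 - s)\<^sup>2 - x * s\<^sup>2" by algebra
    finally show "(?G has_vector_derivative ((1 - s)\<^sup>2 - x * s\<^sup>2) / (1 - s + x * s)\<^sup>2) (at s within {0..1})"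
      by (simp add: has_real_derivative_iff_has_vector_derivative power2_eq_square)
  qed simp
  then have "((\<lambda>s. ((1 - s)\<^sup>2 - x * s\<^sup>2) / (1 - s + x * s)\<^sup>2) has_integral 0) {0..1}" by simp
  from has_integral_mult_right[OF has_integral_diff[OF shearer_slope_has_integral[OF x] this], of x]
  have "((\<lambda>s. x * (((1 - s) / (1 - s + x * s))\<^sup>2 - ((1 - s)\<^sup>2 - x * s\<^sup>2) / (1 - s + x * s)\<^sup>2))
      has_integral x * shearer_slope x) {0..1}" by simp
  moreover have "x * (((1 - s) / (1 - s + x * s))\<^sup>2 - ((1 - s)\<^sup>2 - x * s\<^sup>2) / (1 - s + x * s)\<^sup>2)
      = (x * s / (1 - s + x * s))\<^sup>2" for s
    by (simp add: power_divide power_mult_distrib power2_eq_square flip: diff_divide_distrib)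
  ultimately show ?thesis by simp
qed

text \<open>With \<open>f = shearer\<close> this reads \<open>1 + (x - x\<^sup>2) f' = (x + 1) f\<close>, the differential equation from which
  Shearer's function arises. In the integral forms it is the pointwise identity
  \<open>2 p - p\<^sup>2 + (1 - p)\<^sup>2 = 1\<close> with \<open>p = (1 - s) / (1 - s + x * s)\<close>.\<close>

lemma shearer_ode:
  fixes x :: real
  assumes x: "0 < x"
  shows "1 - shearer x = x * shearer_slope x + (shearer x - shearer_slope x)"
proof -
  have one: "((\<lambda>s::real. 1::real) has_integral 1) {0..1}"
    using has_integral_const_real[of "1::real" 0 1] by simp
  have h: "((\<lambda>s. (1 - s) / (1 - s + x * s)) has_integral shearer x) {0..1}"
    using x by (intro shearer_has_integral) simp
  have "((\<lambda>s. 2 * ((1 - s) / (1 - s + x * s)) - ((1 - s) / (1 - s + x * s))\<^sup>2 + (x * s / (1 - s + x * s))\<^sup>2)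
      has_integral 2 * shearer x - shearer_slope x + x * shearer_slope x) {0..1}"
    by (intro has_integral_add has_integral_diff has_integral_mult_right h
        shearer_slope_has_integral shearer_slope_times_has_integral x)
  moreover have "2 * ((1 - s) / (1 - s + x * s)) - ((1 - s) / (1 - s + x * s))\<^sup>2 + (x * s / (1 - s + x * s))\<^sup>2 = 1"
    if "s \<in> {0..1}" for s :: real
  proof -
    define a b where "a = 1 - s" and "b = x * s"
    have "a + b \<noteq> 0" using denom_pos[OF x, of s] that by (simp add: a_def b_def)
    then have "2 * (a / (a + b)) - (a / (a + b))\<^sup>2 + (b / (a + b))\<^sup>2 = 1"
      by (simp add: divide_simps power2_eq_square) (simp add: algebra_simps)
    then show ?thesis by (simp add: a_def b_def)
  qed
  ultimately have "((\<lambda>s::real. 1::real) has_integral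
      2 * shearer x - shearer_slope x + x * shearer_slope x) {0..1}"
    by (rule has_integral_eq[rotated])
  from has_integral_unique[OF this one] show ?thesis by simp
qed

lemma shearer_nonneg: "0 \<le> t \<Longrightarrow> 0 \<le> shearer t"
  using shearer_has_integral[of t]
  by (rule has_integral_nonneg) auto

lemma shearer_slope_nonneg: "0 < x \<Longrightarrow> 0 \<le> shearer_slope x"
  using shearer_slope_has_integral[of x]
  by (rule has_integral_nonneg) auto

lemma shearer_slope_le:
  fixes x :: real
  assumes x: "0 < x"
  shows "shearer_slope x \<le> shearer x"
proof (rule has_integral_le[OF shearer_slope_has_integral[OF x] shearer_has_integral])
  fix s :: real
  assume s: "s \<in> {0..1}"
  then have p: "0 < 1 - s + x * s" using denom_pos[OF x, of s] by simp
  have "(1 - s) / (1 - s + x * s) \<le> 1" "0 \<le> (1 - s) / (1 - s + x * s)"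
    using p s x by (auto simp: divide_simps)
  then show "((1 - s) / (1 - s + x * s))\<^sup>2 \<le> (1 - s) / (1 - s + x * s)"
    unfolding power2_eq_square by (rule mult_left_le)
qed (use x in simp)

lemma shearer_le_1: "0 \<le> t \<Longrightarrow> shearer t \<le> 1"
proof (cases "t = 0")
  case False
  assume "0 \<le> t"
  with False have t: "0 < t" by simp
  have "0 \<le> t * shearer_slope t" using t shearer_slope_nonneg[OF t] by simp
  then show ?thesis using shearer_ode[OF t] shearer_slope_le[OF t] by linarith
qed (simp add: shearer_def)

text \<open>Convexity: the integrand is convex in \<open>t\<close>, so the tangent inequality at \<open>x\<close> holds under the integral.\<close>

lemma shearer_tangent:
  fixes x t :: real
  assumes x: "0 < x" and t: "0 \<le> t"
  shows "shearer x + (shearer x - shearer_slope x) * (1 - t / x) \<le> shearer t"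
proof -
  have h: "((\<lambda>s. (1 - s) / (1 - s + x * s)) has_integral shearer x) {0..1}"
    using x by (intro shearer_has_integral) simp
  have "((\<lambda>s. (1 - s) / (1 - s + x * s) + ((1 - s) / (1 - s + x * s) - ((1 - s) / (1 - s + x * s))\<^sup>2) * (1 - t / x))
      has_integral shearer x + (shearer x - shearer_slope x) * (1 - t / x)) {0..1}"
    by (intro has_integral_add has_integral_diff has_integral_mult_left h
        shearer_slope_has_integral x)
  then show ?thesis
  proof (rule has_integral_le[OF _ shearer_has_integral[OF t]])
    fix s :: real
    assume s: "s \<in> {0..1}"
    define A where "A = 1 - s + x * s"
    define B where "B = 1 - s + t * s"
    have A: "0 < A" using denom_pos[OF x, of s] s by (simp add: A_def)
    have l: "(1 - s) / A + ((1 - s) / A - ((1 - s) / A)\<^sup>2) * (1 - t / x)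
        = (1 - s) * (A + s * (x - t)) / A\<^sup>2"
    proof -
      have "(1 - s) / A - ((1 - s) / A)\<^sup>2 = (1 - s) * (x * s) / A\<^sup>2"
        using A by (simp add: field_simps power2_eq_square) (simp add: A_def algebra_simps)
      moreover have "x * (1 - t / x) = x - t" using x by (simp add: field_simps)
      ultimately have "((1 - s) / A - ((1 - s) / A)\<^sup>2) * (1 - t / x) = (1 - s) * (s * (x - t)) / A\<^sup>2"
        by (metis (no_types, lifting) mult.assoc mult.commute times_divide_eq_left)
      moreover have "(1 - s) / A = (1 - s) * A / A\<^sup>2" using A by (simp add: power2_eq_square)
      ultimately show ?thesis by (simp add: add_divide_distrib distrib_left)
    qed
    show "(1 - s) / (1 - s + x * s) + ((1 - s) / (1 - s + x * s) - ((1 - s) / (1 - s + x * s))\<^sup>2) * (1 - t / x)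
       \<le> (1 - s) / (1 - s + t * s)"
    proof (cases "s = 1")
      case False
      then have B: "0 < B" using s t by (auto simp: B_def intro!: add_pos_nonneg)
      have "(A + s * (x - t)) * B \<le> A\<^sup>2"
      proof -
        have "A\<^sup>2 - (A + s * (x - t)) * B = (s * (x - t))\<^sup>2"
          by (simp add: A_def B_def power2_eq_square algebra_simps)
        then show ?thesis by (smt (verit) zero_le_power2)
      qed
      then have "(A + s * (x - t)) / A\<^sup>2 \<le> 1 / B" using A B by (simp add: divide_simps mult.commute)
      then have "(1 - s) * ((A + s * (x - t)) / A\<^sup>2) \<le> (1 - s) * (1 / B)"
        using s by (intro mult_left_mono) auto
      then show ?thesis using l by (simp add: A_def B_def)
    qed simp
  qed
qed

lemma shearer_antimono:
  fixes s t :: real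
  assumes "0 \<le> s" "s \<le> t"
  shows "shearer t \<le> shearer s"
proof (cases "t = 0")
  case False
  then have t: "0 < t" using assms by simp
  have "0 \<le> (shearer t - shearer_slope t) * (1 - s / t)"
    using shearer_slope_le[OF t] assms t by (intro mult_nonneg_nonneg) auto
  then show ?thesis using shearer_tangent[OF t assms(1)] by linarith
qed (use assms in simp)

lemma mult_shearer_deriv:
  fixes x :: real
  assumes x: "0 < x"
  shows "((\<lambda>t. t * shearer t) has_real_derivative shearer_slope x) (at x)"
proof -
  let ?f = "\<lambda>t s::real. t * ((1 - s) / (1 - s + t * s))"
  have "((\<lambda>t. integral (cbox 0 1) (?f t)) has_field_derivative
      integral (cbox 0 1) (\<lambda>s. ((1 - s) / (1 - s + x * s))\<^sup>2)) (at x within {0<..})"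
  proof (rule leibniz_rule_field_derivative)
    fix t s :: real
    assume t: "t \<in> {0<..}" and s: "s \<in> cbox 0 1"
    then have p: "1 - s + t * s \<noteq> 0" using denom_pos[of t s] by (simp add: cbox_interval)
    have d: "((\<lambda>t. 1 - s + t * s) has_field_derivative s) (at t within {0<..})"
      by (auto intro!: derivative_eq_intros)
    have "((\<lambda>t. ?f t s) has_field_derivative
        1 * ((1 - s) / (1 - s + t * s)) + (0 * (1 - s + t * s) - (1 - s) * s)
          / ((1 - s + t * s) * (1 - s + t * s)) * t) (at t within {0<..})"
      by (rule DERIV_mult[OF DERIV_ident DERIV_divide[OF DERIV_const d p]])
    also have "1 * ((1 - s) / (1 - s + t * s)) + (0 * (1 - s + t * s) - (1 - s) * s)
          / ((1 - s + t * s) * (1 - s + t * s)) * t = ((1 - s) / (1 - s + t * s))\<^sup>2"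
    proof -
      define A where "A = 1 - s + t * s"
      have "A \<noteq> 0" using p by (simp add: A_def)
      then have "1 * ((1 - s) / A) + (0 * A - (1 - s) * s) / (A * A) * t
          = ((1 - s) * A - (1 - s) * (t * s)) / (A * A)"
        by (simp add: diff_divide_distrib)
      also have "(1 - s) * A - (1 - s) * (t * s) = (1 - s) * (1 - s)"
        by (simp add: A_def algebra_simps)
      finally show ?thesis
        unfolding A_def[symmetric] by (simp add: power2_eq_square)
    qed
    finally show "((\<lambda>t. ?f t s) has_field_derivative ((1 - s) / (1 - s + t * s))\<^sup>2) (at t within {0<..})" .
  next
    fix t :: real
    assume "t \<in> {0<..}"
    then show "?f t integrable_on cbox 0 1"
      using has_integral_mult_right[OF shearer_has_integral[of t], of t]
      by (auto simp: cbox_interval)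
  next
    show "continuous_on ({0<..} \<times> cbox 0 1) (\<lambda>(x::real, s::real). ((1 - s) / (1 - s + x * s))\<^sup>2)"
      unfolding split_def
      by (intro continuous_intros) (use denom_pos in \<open>force simp: cbox_interval\<close>)
  qed (use x in auto)
  then have "((\<lambda>t. integral (cbox 0 1) (?f t)) has_real_derivative shearer_slope x) (at x)"
    using x by (simp add: shearer_slope_def cbox_interval at_within_open[of x "{0<..}"])
  moreover have "integral (cbox 0 1) (?f t) = t * shearer t" if "t \<in> {0<..}" for t
    using has_integral_mult_right[OF shearer_has_integral[of t], of t] that
    by (simp add: cbox_interval integral_unique)
  ultimately show ?thesis
    using x by (elim DERIV_cong_ev[THEN iffD1, rotated 3])
      (auto intro!: eventually_nhds_in_open[THEN eventually_mono, of "{0<..}"])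
qed

lemma shearer_slope_times_mono:
  fixes x z :: real
  assumes z: "0 < z" and le: "z \<le> x"
  shows "z * shearer_slope z \<le> x * shearer_slope x"
proof -
  have x: "0 < x" using assms by simp
  show ?thesis
  proof (rule has_integral_le[OF shearer_slope_times_has_integral[OF z]
        shearer_slope_times_has_integral[OF x]])
    fix s :: real
    assume s: "s \<in> {0..1}"
    have A: "0 < 1 - s + x * s" and B: "0 < 1 - s + z * s"
      using s denom_pos x z by auto
    have "z * s * (1 - s) \<le> x * s * (1 - s)"
      using s le by (intro mult_right_mono) auto
    then have "z * s / (1 - s + z * s) \<le> x * s / (1 - s + x * s)"
      using A B by (simp add: divide_simps) (simp add: algebra_simps)
    then show "(z * s / (1 - s + z * s))\<^sup>2 \<le> (x * s / (1 - s + x * s))\<^sup>2"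
      using s z B by (intro power_mono) auto
  qed
qed

text \<open>The function \<open>z * shearer z\<close> is convex in \<open>ln z\<close>, because its derivative there is
  \<open>z * shearer_slope z\<close>, which increases. The bound is the tangent inequality at \<open>ln x\<close>,
  evaluated at \<open>ln (x / b)\<close>.\<close>

lemma shearer_divide_ge:
  fixes x b :: real
  assumes x: "0 < x" and b: "1 \<le> b"
  shows "b * (shearer x - shearer_slope x * ln b) \<le> shearer (x / b)"
proof -
  define H where "H = (\<lambda>z. z * shearer z - x * shearer_slope x * ln z)"
  have z: "0 < x / b" "x / b \<le> x" using x b by (auto simp: divide_simps)
  have "H x \<le> H (x / b)"
  proof (rule DERIV_nonpos_imp_nonincreasing[OF z(2)])
    fix y assume y: "x / b \<le> y" "y \<le> x"
    then have y0: "0 < y" using z by linarith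
    have "(H has_real_derivative shearer_slope y - x * shearer_slope x * (1 / y)) (at y)"
      unfolding H_def
      by (intro DERIV_diff mult_shearer_deriv DERIV_cmult DERIV_ln_divide y0)
    moreover have "shearer_slope y - x * shearer_slope x * (1 / y) \<le> 0"
      using shearer_slope_times_mono[OF y0 y(2)] y0 by (simp add: field_simps)
    ultimately show "\<exists>d. (H has_real_derivative d) (at y) \<and> d \<le> 0" by blast
  qed
  then have "x * shearer x - x * shearer_slope x * ln x
      \<le> x / b * shearer (x / b) - x * shearer_slope x * (ln x - ln b)"
    using x b by (simp add: H_def ln_div)
  then have "x * (shearer x - shearer_slope x * ln b) \<le> x * (shearer (x / b) / b)"
    by (simp add: algebra_simps)
  then have "shearer x - shearer_slope x * ln b \<le> shearer (x / b) / b"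
    using mult_le_cancel_left_pos[OF x] by blast
  then show ?thesis using b by (simp add: field_simps)
qed



section \<open>Vectors dominated by the marginals of a random independent set\<close>

lemma neighbors_subset: "finite_simple_graph V E \<Longrightarrow> neighbors E v \<subseteq> V"
  by (auto simp: finite_simple_graph_def neighbors_def nsets_def)

lemma finite_neighbors: "finite_simple_graph V E \<Longrightarrow> finite (neighbors E v)"
  by (meson finite_simple_graph_def finite_subset neighbors_subset)

lemma neighbors_sym: "u \<in> neighbors E v \<longleftrightarrow> v \<in> neighbors E u"
  by (simp add: neighbors_def insert_commute)

lemma not_self_neighbor: "finite_simple_graph V E \<Longrightarrow> v \<notin> neighbors E v"
  by (auto simp: finite_simple_graph_def neighbors_def nsets_def)

lemma finite_independent_sets: "finite V \<Longrightarrow> finite (independent_sets V E)"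
  by (rule finite_subset[of _ "Pow V"]) (auto simp: independent_sets_def)

lemma empty_independent: "{} \<in> independent_sets V E"
  by (simp add: independent_sets_def)

text \<open>Distributions appear as weights on the finite family of independent sets, so that averages and
  limits become finite sums.\<close>

definition attainable :: "'a set \<Rightarrow> 'a set set \<Rightarrow> ('a \<Rightarrow> real) \<Rightarrow> bool" where
  "attainable V E a \<longleftrightarrow> (\<exists>p. (\<forall>I. 0 \<le> p I) \<and> sum p (independent_sets V E) = 1 \<and>
     (\<forall>u\<in>V. a u \<le> sum p {I \<in> independent_sets V E. u \<in> I}))"

lemma attainable_mono:
  "attainable V E b \<Longrightarrow> (\<And>u. u \<in> V \<Longrightarrow> a u \<le> b u) \<Longrightarrow> attainable V E a"
  unfolding attainable_def by (meson order_trans)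

lemma attainable_indicator:
  assumes V: "finite V" and I: "I \<in> independent_sets V E"
  shows "attainable V E (\<lambda>u. if u \<in> I then 1 else 0)"
  unfolding attainable_def
proof (intro exI[of _ "\<lambda>J. if J = I then 1 else 0"] conjI ballI)
  have fin: "finite {J \<in> independent_sets V E. P J}" for P
    using finite_independent_sets[OF V] by simp
  show "(\<Sum>J\<in>independent_sets V E. if J = I then 1 else (0::real)) = 1"
    using finite_independent_sets[OF V] I by simp
  show "(if u \<in> I then 1 else 0) \<le> (\<Sum>J\<in>{J \<in> independent_sets V E. u \<in> J}. if J = I then 1 else (0::real))" for u
    using fin[of "\<lambda>J. u \<in> J"] I by simp
qed simp

lemma attainable_convex_combination:
  assumes V: "finite V" and A: "finite A"
    and c: "\<And>i. i \<in> A \<Longrightarrow> 0 \<le> c i" "sum c A = 1"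
    and a: "\<And>i. i \<in> A \<Longrightarrow> attainable V E (a i)"
  shows "attainable V E (\<lambda>u. \<Sum>i\<in>A. c i * a i u)"
proof -
  have "\<forall>i\<in>A. \<exists>p. (\<forall>I. 0 \<le> p I) \<and> sum p (independent_sets V E) = 1 \<and>
     (\<forall>u\<in>V. a i u \<le> sum p {I \<in> independent_sets V E. u \<in> I})"
    using a by (simp add: attainable_def)
  then obtain p where p: "\<And>i I. i \<in> A \<Longrightarrow> 0 \<le> p i I"
      "\<And>i. i \<in> A \<Longrightarrow> sum (p i) (independent_sets V E) = 1"
      "\<And>i u. i \<in> A \<Longrightarrow> u \<in> V \<Longrightarrow> a i u \<le> sum (p i) {I \<in> independent_sets V E. u \<in> I}"
    by (auto dest!: bchoice)
  have swap: "(\<Sum>I\<in>B. \<Sum>i\<in>A. c i * p i I) = (\<Sum>i\<in>A. c i * sum (p i) B)" for B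
    by (subst sum.swap) (simp add: sum_distrib_left)
  show ?thesis
    unfolding attainable_def
  proof (intro exI[of _ "\<lambda>I. \<Sum>i\<in>A. c i * p i I"] conjI ballI allI)
    show "0 \<le> (\<Sum>i\<in>A. c i * p i I)" for I
      using c p by (intro sum_nonneg) auto
    show "(\<Sum>I\<in>independent_sets V E. \<Sum>i\<in>A. c i * p i I) = 1"
      using c p by (simp add: swap)
    show "(\<Sum>i\<in>A. c i * a i u) \<le> (\<Sum>I\<in>{I \<in> independent_sets V E. u \<in> I}. \<Sum>i\<in>A. c i * p i I)"
      if "u \<in> V" for u
      unfolding swap using that c p by (intro sum_mono mult_left_mono) auto
  qed
qed

lemma convergent_subsequence_finite:
  fixes p :: "nat \<Rightarrow> 'b \<Rightarrow> real"
  assumes "finite A" and "\<And>i. i \<in> A \<Longrightarrow> Bseq (\<lambda>n. p n i)"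
  shows "\<exists>s. strict_mono s \<and> (\<forall>i\<in>A. convergent (\<lambda>n. p (s n) i))"
  using assms
proof (induction A rule: finite_induct)
  case empty
  show ?case by (rule exI[of _ "\<lambda>n. n"]) (simp add: strict_mono_def)
next
  case (insert i A)
  then obtain s where s: "strict_mono s" "\<And>j. j \<in> A \<Longrightarrow> convergent (\<lambda>n. p (s n) j)" by auto
  obtain t :: "nat \<Rightarrow> nat" where t: "strict_mono t" "monoseq (\<lambda>n. p (s (t n)) i)"
    using seq_monosub[of "\<lambda>n. p (s n) i"] by blast
  have "Bseq (\<lambda>n. p (s (t n)) i)"
    using Bseq_subseq[OF insert.prems[OF insertI1], of "\<lambda>n. s (t n)"] by simp
  then have "convergent (\<lambda>n. p (s (t n)) i)"
    using t by (intro Bseq_monoseq_convergent)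
  moreover have "convergent (\<lambda>n. p (s (t n)) j)" if "j \<in> A" for j
    using convergent_subseq_convergent[OF s(2)[OF that] t(1)] by (simp add: o_def)
  moreover have "strict_mono (\<lambda>n. s (t n))"
    using strict_mono_o[OF s(1) t(1)] by (simp add: o_def)
  ultimately show ?case by blast
qed

text \<open>Compactness of the simplex of distributions.\<close>

lemma attainable_closed:
  assumes V: "finite V" and a: "\<And>\<epsilon>. 0 < \<epsilon> \<Longrightarrow> attainable V E (\<lambda>u. a u - \<epsilon>)"
  shows "attainable V E a"
proof -
  note fin = finite_independent_sets[OF V, of E]
  have "\<forall>n. \<exists>p. (\<forall>I. 0 \<le> p I) \<and> sum p (independent_sets V E) = 1 \<and>
     (\<forall>u\<in>V. a u - inverse (real (Suc n)) \<le> sum p {I \<in> independent_sets V E. u \<in> I})"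
    using a by (simp add: attainable_def)
  then obtain p where p: "\<And>n I. 0 \<le> p n I"
      "\<And>n. sum (p n) (independent_sets V E) = 1"
      "\<And>n u. u \<in> V \<Longrightarrow> a u - inverse (real (Suc n)) \<le> sum (p n) {I \<in> independent_sets V E. u \<in> I}"
    by (auto dest!: choice)
  have "Bseq (\<lambda>n. p n I)" if "I \<in> independent_sets V E" for I
  proof (rule BseqI')
    show "norm (p n I) \<le> 1" for n
      using member_le_sum[OF that, of "p n"] fin p by simp
  qed
  then obtain s where s: "strict_mono s"
      "\<And>I. I \<in> independent_sets V E \<Longrightarrow> convergent (\<lambda>n. p (s n) I)"
    using convergent_subsequence_finite[OF fin, of p] by blast
  define P where "P = (\<lambda>I. if I \<in> independent_sets V E then lim (\<lambda>n. p (s n) I) else 0)"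
  have lim: "(\<lambda>n. p (s n) I) \<longlonglongrightarrow> P I" if "I \<in> independent_sets V E" for I
    using s(2)[OF that] that by (simp add: P_def convergent_LIMSEQ_iff)
  have lim_sum: "(\<lambda>n. sum (p (s n)) B) \<longlonglongrightarrow> sum P B" if "B \<subseteq> independent_sets V E" for B
    using that lim by (intro tendsto_sum) auto
  show ?thesis
    unfolding attainable_def
  proof (intro exI[of _ P] conjI ballI allI)
    show "0 \<le> P I" for I
      using LIMSEQ_le_const[OF lim, of I 0] p by (cases "I \<in> independent_sets V E") (auto simp: P_def)
    show "sum P (independent_sets V E) = 1"
      using lim_sum[OF order_refl] p(2) by (simp add: LIMSEQ_const_iff)
    fix u assume u: "u \<in> V"
    have "(\<lambda>n. inverse (real (Suc (s n)))) \<longlonglongrightarrow> 0"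
      using LIMSEQ_subseq_LIMSEQ[OF LIMSEQ_inverse_real_of_nat s(1)] by (simp add: o_def)
    from tendsto_diff[OF tendsto_const this, of "a u"]
    show "a u \<le> sum P {I \<in> independent_sets V E. u \<in> I}"
      using LIMSEQ_le[OF _ lim_sum, of "\<lambda>n. a u - inverse (real (Suc (s n)))" "a u" "{I \<in> independent_sets V E. u \<in> I}"]
        p(3)[OF u] by auto
  qed
qed

lemma attainable_imp_pmf:
  assumes V: "finite V" and a: "attainable V E a"
  shows "\<exists>\<mu> :: 'a set pmf. set_pmf \<mu> \<subseteq> independent_sets V E \<and> (\<forall>u\<in>V. a u \<le> occupancy \<mu> u)"
proof -
  obtain p where p: "\<And>I. 0 \<le> p I" "sum p (independent_sets V E) = 1"
      "\<And>u. u \<in> V \<Longrightarrow> a u \<le> sum p {I \<in> independent_sets V E. u \<in> I}"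
    using a by (auto simp: attainable_def)
  note fin = finite_independent_sets[OF V, of E]
  define P where "P = (\<lambda>I. if I \<in> independent_sets V E then p I else 0)"
  have P0: "0 \<le> P I" for I by (simp add: P_def p)
  have "(\<integral>\<^sup>+ I. ennreal (P I) \<partial>count_space UNIV) = (\<Sum>I\<in>independent_sets V E. ennreal (P I))"
    by (intro nn_integral_count_space'[OF fin]) (auto simp: P_def)
  also have "\<dots> = ennreal (\<Sum>I\<in>independent_sets V E. P I)" by (rule sum_ennreal) (rule P0)
  also have "(\<Sum>I\<in>independent_sets V E. P I) = 1" using p by (simp add: P_def)
  finally have one: "(\<integral>\<^sup>+ I. ennreal (P I) \<partial>count_space UNIV) = 1" by simp
  define \<mu> where "\<mu> = embed_pmf P"
  have pm: "pmf \<mu> I = P I" for I unfolding \<mu>_def by (rule pmf_embed_pmf[OF P0 one])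
  have sub: "set_pmf \<mu> \<subseteq> independent_sets V E" by (auto simp: set_pmf_eq pm P_def)
  have "occupancy \<mu> u = sum p {I \<in> independent_sets V E. u \<in> I}" for u
  proof -
    have "occupancy \<mu> u = measure_pmf.prob \<mu> {I \<in> independent_sets V E. u \<in> I}"
      unfolding occupancy_def using sub
      by (intro measure_pmf.finite_measure_eq_AE) (auto simp: AE_measure_pmf_iff)
    also have "\<dots> = sum (pmf \<mu>) {I \<in> independent_sets V E. u \<in> I}"
      using fin by (intro measure_measure_pmf_finite) simp
    also have "\<dots> = sum p {I \<in> independent_sets V E. u \<in> I}"
      by (intro sum.cong) (auto simp: pm P_def)
    finally show ?thesis .
  qed
  then show ?thesis using p(3) sub by auto
qed

section \<open>Fractional colourings\<close>

definition fractional_coloring :: "real \<Rightarrow> 'a set \<Rightarrow> 'a set set \<Rightarrow> ('a set \<Rightarrow> real) \<Rightarrow> bool" where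
  "fractional_coloring r V E p \<longleftrightarrow> (\<forall>S. 0 \<le> p S) \<and> sum p (independent_sets V E) = 1 \<and>
     (\<forall>u\<in>V. sum p {S \<in> independent_sets V E. u \<in> S} = 1 / r)"

lemma fractional_coloring_pmf:
  assumes V: "finite V" and sub: "set_pmf \<nu> \<subseteq> independent_sets V E"
    and occ: "\<And>u. u \<in> V \<Longrightarrow> occupancy \<nu> u = 1 / r"
  shows "fractional_coloring r V E (pmf \<nu>)"
  unfolding fractional_coloring_def
proof (intro conjI allI ballI)
  note fin = finite_independent_sets[OF V, of E]
  show "sum (pmf \<nu>) (independent_sets V E) = 1" by (rule sum_pmf_eq_1[OF fin sub])
  fix u assume "u \<in> V"
  have "sum (pmf \<nu>) {S \<in> independent_sets V E. u \<in> S} = measure_pmf.prob \<nu> {S \<in> independent_sets V E. u \<in> S}"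
    using fin by (intro measure_measure_pmf_finite[symmetric]) simp
  also have "\<dots> = occupancy \<nu> u"
    unfolding occupancy_def using sub
    by (intro measure_pmf.finite_measure_eq_AE) (auto simp: AE_measure_pmf_iff)
  finally show "sum (pmf \<nu>) {S \<in> independent_sets V E. u \<in> S} = 1 / r" using occ[OF \<open>u \<in> V\<close>] by simp
qed simp

text \<open>Discarding the sampled set with probability \<open>1 - r / r'\<close> lowers all marginals from \<open>1 / r\<close> to
  \<open>1 / r'\<close>.\<close>

lemma fractional_coloring_thin:
  assumes V: "finite V" and p: "fractional_coloring r V E p" and r: "0 < r" "r \<le> r'"
  shows "fractional_coloring r' V E (\<lambda>S. r / r' * p S + (if S = {} then 1 - r / r' else 0))"
  unfolding fractional_coloring_def
proof (intro conjI allI ballI)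
  note fin = finite_independent_sets[OF V, of E]
  show "0 \<le> r / r' * p S + (if S = {} then 1 - r / r' else 0)" for S
    using p r by (auto simp: fractional_coloring_def)
  show "(\<Sum>S\<in>independent_sets V E. r / r' * p S + (if S = {} then 1 - r / r' else 0)) = 1"
    unfolding sum.distrib sum_distrib_left[symmetric]
    using p fin empty_independent[of V E] by (simp add: fractional_coloring_def)
  fix u assume u: "u \<in> V"
  have "(\<Sum>S\<in>{S \<in> independent_sets V E. u \<in> S}. r / r' * p S + (if S = {} then 1 - r / r' else 0))
      = r / r' * sum p {S \<in> independent_sets V E. u \<in> S}"
    unfolding sum_distrib_left by (intro sum.cong) auto
  then show "(\<Sum>S\<in>{S \<in> independent_sets V E. u \<in> S}. r / r' * p S + (if S = {} then 1 - r / r' else 0)) = 1 / r'"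
    using p u r by (simp add: fractional_coloring_def)
qed

lemma fractional_coloring_average:
  assumes V: "finite V" and p: "fractional_coloring r V E p" and T: "T \<subseteq> V"
  shows "(\<Sum>S\<in>independent_sets V E. p S * sum w (T \<inter> S)) = sum w T / r"
proof -
  note fin = finite_independent_sets[OF V, of E]
  have finT: "finite T" using V T finite_subset by blast
  have "(\<Sum>S\<in>independent_sets V E. p S * sum w (T \<inter> S))
      = (\<Sum>S\<in>independent_sets V E. \<Sum>z\<in>T. if z \<in> S then p S * w z else 0)"
    using finT by (auto simp: sum_distrib_left sum.inter_restrict intro!: sum.cong)
  also have "\<dots> = (\<Sum>z\<in>T. \<Sum>S\<in>independent_sets V E. if z \<in> S then p S * w z else 0)"
    by (rule sum.swap)
  also have "\<dots> = (\<Sum>z\<in>T. w z * sum p {S \<in> independent_sets V E. z \<in> S})"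
    using fin by (auto simp: sum.inter_filter[symmetric] sum_distrib_left mult.commute intro!: sum.cong)
  also have "\<dots> = (\<Sum>z\<in>T. w z * (1 / r))"
    using p T by (intro sum.cong) (auto simp: fractional_coloring_def)
  finally show ?thesis by (simp add: sum_divide_distrib)
qed

section \<open>The averaging inequality\<close>

text \<open>A vertex of weight zero counts as deleted: it demands nothing, and it does not contribute to the
  degrees of its neighbours.\<close>

definition demand :: "real \<Rightarrow> 'a set set \<Rightarrow> ('a \<Rightarrow> real) \<Rightarrow> 'a \<Rightarrow> real" where
  "demand K E w u = (if 0 < w u then shearer (K * weighted_degree E w u) else 0)"

text \<open>Both kinds of local change have this form: the empty set \<open>S\<close> clears the neighbourhood of \<open>v\<close> and so
  leaves \<open>v\<close> isolated.\<close>

definition reweight :: "'a set set \<Rightarrow> real \<Rightarrow> 'a \<Rightarrow> 'a set \<Rightarrow> ('a \<Rightarrow> real) \<Rightarrow> 'a \<Rightarrow> real" where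
  "reweight E b v S w z = (if z \<in> neighbors E v then if z \<in> S then b * w z else 0 else w z)"

lemma reweight_nonneg:
  "0 \<le> b \<Longrightarrow> 0 \<le> w z \<Longrightarrow> 0 \<le> reweight E b v S w z"
  by (simp add: reweight_def)

lemma sum_reweight:
  assumes "finite T"
  shows "sum (reweight E b v S w) T = sum w T - sum w (T \<inter> neighbors E v) + b * sum w (T \<inter> neighbors E v \<inter> S)"
proof -
  let ?N = "neighbors E v"
  have "sum (reweight E b v S w) T
      = sum (reweight E b v S w) (T - ?N) + sum (reweight E b v S w) (T \<inter> ?N)"
    using assms by (metis add.commute sum.Int_Diff)
  also have "sum (reweight E b v S w) (T - ?N) = sum w (T - ?N)"
    by (intro sum.cong) (auto simp: reweight_def)
  also have "\<dots> = sum w T - sum w (T \<inter> ?N)"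
    using assms by (simp add: sum.Int_Diff[of T w ?N])
  also have "sum (reweight E b v S w) (T \<inter> ?N) = (\<Sum>z\<in>T \<inter> ?N. if z \<in> S then b * w z else 0)"
    by (intro sum.cong) (auto simp: reweight_def)
  also have "\<dots> = b * sum w (T \<inter> ?N \<inter> S)"
    using assms by (auto simp: sum.inter_restrict sum_distrib_left intro!: sum.cong)
  finally show ?thesis .
qed

lemma demand_bounds:
  assumes "0 \<le> K" "\<And>z. z \<in> neighbors E u \<Longrightarrow> 0 \<le> w z"
  shows "0 \<le> demand K E w u" "demand K E w u \<le> 1"
  using assms by (auto simp: demand_def weighted_degree_def sum_nonneg
      intro!: shearer_nonneg shearer_le_1)

text \<open>Divided by \<open>K * sum w V\<close>, the right-hand side is the expected demand of \<open>u\<close> after the random local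
  change: \<open>v\<close> is drawn proportionally to \<open>w\<close>, the set \<open>S\<close> from \<open>q v\<close>, and the neighbourhood is cleared with
  probability \<open>(K - 1) / K\<close>. With \<open>h = shearer x\<close> and \<open>e = shearer_slope x\<close> at \<open>x = K * D / w u\<close>, the
  contribution of \<open>v\<close> is at least
   \<^item> \<open>K * h\<close> if \<open>v\<close> is neither \<open>u\<close> nor adjacent to \<open>u\<close>, by the tangent inequality, whose linear terms cancel
     because \<open>r * K / r = K\<close>;
   \<^item> \<open>K * h + (K - 1) * x * e\<close> if \<open>v = u\<close>, by the differential equation: clearing \<open>N u\<close> raises the
     demand to \<open>1\<close>, and the tangent inequality bounds the loss under the other option;
   \<^item> \<open>K * h - K * (K - 1) * e\<close> if \<open>v\<close> is adjacent to \<open>u\<close>, by the logarithmic convexity bound, since \<open>u\<close> lies in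
     \<open>S\<close> with probability \<open>1 / r\<close>, its degree is then divided by at least \<open>r * K\<close>, and \<open>ln (r * K) = K - 1\<close>.
  Weighted by \<open>w\<close>, the surplus \<open>w u * (K - 1) * x * e\<close> and the total deficit \<open>D * K * (K - 1) * e\<close> are
  equal by the choice of \<open>x\<close>; here \<open>D\<close> is the total weight of \<open>N u\<close>.\<close>

lemma demand_le_average:
  fixes K r :: real and w :: "'a \<Rightarrow> real"
  assumes G: "finite_simple_graph V E" and K: "1 < K" and r: "0 < r" and rK: "r * K = exp (K - 1)"
    and q: "\<And>v. v \<in> V \<Longrightarrow> fractional_coloring r (neighbors E v) (induced_edges E (neighbors E v)) (q v)"
    and w: "\<And>v. v \<in> V \<Longrightarrow> 0 \<le> w v" and u: "u \<in> V"
  shows "K * sum w V * demand K E w u \<le> (\<Sum>v\<in>V. w v *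
     ((K - 1) * demand K E (reweight E (r * K) v {} w) u +
      (\<Sum>S\<in>independent_sets (neighbors E v) (induced_edges E (neighbors E v)).
         q v S * demand K E (reweight E (r * K) v S w) u)))"
proof -
  define b where "b = r * K"
  define C where "C = (\<lambda>v. independent_sets (neighbors E v) (induced_edges E (neighbors E v)))"
  define g where "g = (\<lambda>v. (K - 1) * demand K E (reweight E b v {} w) u +
      (\<Sum>S\<in>C v. q v S * demand K E (reweight E b v S w) u))"
  note finN = finite_neighbors[OF G] and subN = neighbors_subset[OF G]
  have b: "1 \<le> b" "ln b = K - 1" "0 < b" using K by (auto simp: b_def rK)
  have wN: "\<And>x z. z \<in> neighbors E x \<Longrightarrow> 0 \<le> w z" using w subN by blast
  have q0: "0 \<le> q v S" and q1: "sum (q v) (C v) = 1"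
    and qr: "\<And>z. z \<in> neighbors E v \<Longrightarrow> sum (q v) {S \<in> C v. z \<in> S} = 1 / r" if "v \<in> V" for v S
    using q[OF that] by (auto simp: fractional_coloring_def C_def)
  have dem0: "0 \<le> demand K E (reweight E b v S w) u" for v S
    using K b wN by (intro demand_bounds reweight_nonneg) auto
  have "K * sum w V * demand K E w u \<le> (\<Sum>v\<in>V. w v * g v)"
  proof (cases "0 < w u")
    case False
    have "0 \<le> (\<Sum>v\<in>V. w v * g v)"
      unfolding g_def using w K q0 dem0
      by (intro sum_nonneg mult_nonneg_nonneg add_nonneg_nonneg) auto
    then show ?thesis using False by (simp add: demand_def)
  next
    case wu: True
    define D where "D = sum w (neighbors E u)"
    have D0: "0 \<le> D" unfolding D_def using wN by (intro sum_nonneg)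
    show ?thesis
    proof (cases "D = 0")
      case True
      then have z0: "w z = 0" if "z \<in> neighbors E u" for z
        using that wN finN by (simp add: D_def sum_nonneg_eq_0_iff)
      have "w v * g v = w v * K" if v: "v \<in> V" for v
      proof (cases "w v = 0")
        case False
        then have "u \<notin> neighbors E v" using z0 neighbors_sym by metis
        moreover have "sum (reweight E b v S w) (neighbors E u) = 0" for S
          using z0 by (intro sum.neutral) (simp add: reweight_def)
        ultimately have "demand K E (reweight E b v S w) u = 1" for S
          using wu by (simp add: demand_def weighted_degree_def shearer_def reweight_def)
        then show ?thesis using q1[OF v] by (simp add: g_def)
      qed simp
      moreover have "demand K E w u = 1"
        using wu True by (simp add: demand_def weighted_degree_def shearer_def D_def)
      moreover from calculation have "(\<Sum>v\<in>V. w v * g v) = sum w V * K"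
        unfolding sum_distrib_right by (intro sum.cong refl)
      ultimately show ?thesis by (simp add: mult.commute)
    next
      case False
      with D0 have D: "0 < D" by simp
      define x where "x = K * D / w u"
      define h where "h = shearer x"
      define e where "e = shearer_slope x"
      have x: "0 < x" using K D wu by (simp add: x_def)
      have dem: "demand K E w u = h"
        using wu by (simp add: demand_def weighted_degree_def h_def x_def D_def)
      \<comment> \<open>If \<open>u\<close> keeps its weight, its demand obeys the tangent inequality at \<open>x\<close>.\<close>
      have far: "h + (h - e) * ((sum w (neighbors E u \<inter> neighbors E v)
            - b * sum w (neighbors E u \<inter> neighbors E v \<inter> S)) / D)
          \<le> demand K E (reweight E b v S w) u" if "u \<notin> neighbors E v" for v S
      proof -
        let ?T = "neighbors E u \<inter> neighbors E v"
        let ?D = "D - sum w ?T + b * sum w (?T \<inter> S)"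
        have D': "sum (reweight E b v S w) (neighbors E u) = ?D"
          by (simp add: sum_reweight finN D_def)
        have "0 \<le> ?D"
          unfolding D'[symmetric] using b wN by (intro sum_nonneg reweight_nonneg) auto
        then have "h + (h - e) * (1 - K * ?D / w u / x) \<le> shearer (K * ?D / w u)"
          unfolding h_def e_def using x K wu by (intro shearer_tangent) auto
        moreover have "1 - K * ?D / w u / x = (sum w ?T - b * sum w (?T \<inter> S)) / D"
          using K wu D by (simp add: x_def field_simps)
        moreover have "reweight E b v S w u = w u" using that by (simp add: reweight_def)
        ultimately show ?thesis
          using wu by (simp add: demand_def weighted_degree_def D')
      qed
      have g_far: "(K - 1) * demand K E (reweight E b v {} w) u + h
          - (K - 1) * (h - e) * (sum w (neighbors E u \<inter> neighbors E v) / D) \<le> g v"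
        if v: "v \<in> V" and uv: "u \<notin> neighbors E v" for v
      proof -
        let ?t = "sum w (neighbors E u \<inter> neighbors E v)"
        define s where "s = (\<lambda>S. sum w (neighbors E u \<inter> neighbors E v \<inter> S))"
        have avg: "(\<Sum>S\<in>C v. q v S * s S) = ?t / r"
          unfolding C_def s_def by (intro fractional_coloring_average finN q v) auto
        have "h - (K - 1) * (h - e) * (?t / D) = h + (h - e) * ((?t - b * (?t / r)) / D)"
          using r D by (simp add: b_def field_simps)
        also have "\<dots> = (\<Sum>S\<in>C v. q v S) * (h + (h - e) * (?t / D)) - (h - e) * b / D * (\<Sum>S\<in>C v. q v S * s S)"
          unfolding avg q1[OF v] by (simp add: diff_divide_distrib algebra_simps)
        also have "\<dots> = (\<Sum>S\<in>C v. q v S * (h + (h - e) * ((?t - b * s S) / D)))"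
          unfolding sum_distrib_left sum_distrib_right sum_subtractf[symmetric]
          by (intro sum.cong refl) (simp add: diff_divide_distrib algebra_simps)
        also have "\<dots> \<le> (\<Sum>S\<in>C v. q v S * demand K E (reweight E b v S w) u)"
          using q0[OF v] far[OF uv] unfolding s_def by (intro sum_mono mult_left_mono)
        finally show ?thesis by (simp add: g_def)
      qed
      have g_self: "(K - 1) * (1 - (h - e)) + h \<le> g u"
      proof -
        have "sum (reweight E b u {} w) (neighbors E u) = 0" by (simp add: sum_reweight finN)
        then have "demand K E (reweight E b u {} w) u = 1"
          using wu not_self_neighbor[OF G, of u]
          by (simp add: demand_def weighted_degree_def shearer_def reweight_def)
        moreover have "sum w (neighbors E u \<inter> neighbors E u) / D = 1" using D by (simp add: D_def)
        ultimately show ?thesis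
          using g_far[OF u not_self_neighbor[OF G]] by (simp add: algebra_simps)
      qed
      have g_other: "K * h \<le> g v" if v: "v \<in> V" and uv: "u \<notin> neighbors E v" for v
      proof -
        have "(K - 1) * (h + (h - e) * (sum w (neighbors E u \<inter> neighbors E v) / D))
            \<le> (K - 1) * demand K E (reweight E b v {} w) u"
          using far[OF uv, of "{}"] K by (intro mult_left_mono) auto
        then show ?thesis using g_far[OF v uv] by (simp add: algebra_simps)
      qed
      have g_near: "K * (h - e * (K - 1)) \<le> g v" if v: "v \<in> V" and uv: "u \<in> neighbors E v" for v
      proof -
        have near: "b * (h - e * (K - 1)) \<le> demand K E (reweight E b v S w) u"
          if S: "S \<in> C v" and uS: "u \<in> S" for S
        proof -
          \<comment> \<open>Independence of \<open>S\<close> enters here: no neighbour of \<open>u\<close> gains weight.\<close>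
          have "neighbors E u \<inter> neighbors E v \<inter> S = {}"
          proof -
            have "{u, z} \<notin> E" if "z \<in> S" "z \<in> neighbors E v" "z \<noteq> u" for z
              using S uS that uv
              by (auto simp: C_def independent_sets_def indep_def induced_edges_def)
            moreover have "u \<notin> neighbors E u" by (rule not_self_neighbor[OF G])
            ultimately have "z \<notin> neighbors E u" if "z \<in> S" "z \<in> neighbors E v" for z
              using that by (cases "z = u") (auto simp: neighbors_def)
            then show ?thesis by blast
          qed
          then have D': "sum (reweight E b v S w) (neighbors E u) = D - sum w (neighbors E u \<inter> neighbors E v)"
            by (simp add: sum_reweight finN D_def)
          define D2 where "D2 = D - sum w (neighbors E u \<inter> neighbors E v)"
          have D2: "0 \<le> D2" "D2 \<le> D"
            unfolding D2_def D_def using wN finN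
            by (auto intro!: sum_nonneg sum_mono2)
          have ru: "reweight E b v S w u = b * w u" using uv uS by (simp add: reweight_def)
          have "b * (h - e * (K - 1)) \<le> shearer (x / b)"
            unfolding h_def e_def b(2)[symmetric] by (rule shearer_divide_ge[OF x b(1)])
          also have "\<dots> \<le> shearer (K * D2 / (b * w u))"
          proof (rule shearer_antimono)
            show "0 \<le> K * D2 / (b * w u)" using K D2 b wu by simp
            have "K * D2 / (b * w u) \<le> K * D / (b * w u)"
              using K D2 b wu by (intro divide_right_mono mult_left_mono) auto
            then show "K * D2 / (b * w u) \<le> x / b" by (simp add: x_def mult.commute)
          qed
          also have "\<dots> = demand K E (reweight E b v S w) u"
            using wu b by (simp add: demand_def weighted_degree_def D' ru D2_def)
          finally show ?thesis .
        qed
        have "K * (h - e * (K - 1)) = (\<Sum>S\<in>{S \<in> C v. u \<in> S}. q v S) * (b * (h - e * (K - 1)))"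
          using qr[OF v uv] r by (simp add: b_def)
        also have "\<dots> \<le> (\<Sum>S\<in>{S \<in> C v. u \<in> S}. q v S * demand K E (reweight E b v S w) u)"
          unfolding sum_distrib_right using q0[OF v] near by (intro sum_mono mult_left_mono) auto
        also have "\<dots> \<le> (\<Sum>S\<in>C v. q v S * demand K E (reweight E b v S w) u)"
          using q0[OF v] dem0 finite_independent_sets[OF finN]
          by (intro sum_mono2) (auto simp: C_def)
        also have "\<dots> \<le> g v" using K dem0 by (simp add: g_def)
        finally show ?thesis .
      qed
      have ode: "1 - h - (h - e) = x * e"
        using shearer_ode[OF x] by (simp add: h_def e_def)
      have le: "K * h + (if v = u then (K - 1) * (1 - h - (h - e)) else 0)
          - (if v \<in> neighbors E u then K * e * (K - 1) else 0) \<le> g v" if v: "v \<in> V" for v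
      proof -
        consider "v = u" | "v \<noteq> u" "v \<in> neighbors E u" | "v \<noteq> u" "v \<notin> neighbors E u" by blast
        then show ?thesis
        proof cases
          case 1
          then show ?thesis using g_self not_self_neighbor[OF G, of u] by (simp add: algebra_simps)
        next
          case 2
          then show ?thesis using g_near[OF v] neighbors_sym[of u E v] by (simp add: algebra_simps)
        next
          case 3
          then show ?thesis using g_other[OF v] neighbors_sym[of u E v] by simp
        qed
      qed
      have "K * sum w V * h = K * h * sum w V + (K - 1) * (w u * (x * e) - K * e * D)"
        using wu by (simp add: x_def)
      also have "\<dots> = (\<Sum>v\<in>V. w v * (K * h + (if v = u then (K - 1) * (1 - h - (h - e)) else 0)
          - (if v \<in> neighbors E u then K * e * (K - 1) else 0)))"
      proof -
        have V: "finite V" using G by (simp add: finite_simple_graph_def)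
        have "(\<Sum>v\<in>V. w v * (if v \<in> neighbors E u then K * e * (K - 1) else 0))
            = (\<Sum>v\<in>V \<inter> neighbors E u. w v * (K * e * (K - 1)))"
          unfolding sum.inter_restrict[OF V] by (intro sum.cong) auto
        then have "(\<Sum>v\<in>V. w v * (if v \<in> neighbors E u then K * e * (K - 1) else 0)) = D * (K * e * (K - 1))"
          using subN[of u] by (simp add: D_def Int_absorb1 flip: sum_distrib_right)
        moreover have "(\<Sum>v\<in>V. w v * (if v = u then (K - 1) * (1 - h - (h - e)) else 0)) = w u * ((K - 1) * (x * e))"
          using V u by (simp add: ode if_distrib[of "\<lambda>t. _ * t"] cong: if_cong)
        moreover have "(\<Sum>v\<in>V. w v * (K * h)) = K * h * sum w V"
          by (simp add: mult.commute flip: sum_distrib_right)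
        ultimately show ?thesis
          by (simp only: distrib_left right_diff_distrib sum.distrib sum_subtractf) (simp add: algebra_simps)
      qed
      also have "\<dots> \<le> (\<Sum>v\<in>V. w v * g v)"
        using le w by (intro sum_mono mult_left_mono) auto
      finally show ?thesis by (simp add: dem)
    qed
  qed
  then show ?thesis by (simp add: g_def C_def b_def)
qed


section \<open>Attaining all demands\<close>

text \<open>The local change at \<open>v\<close> has no effect if \<open>v\<close> has no neighbour of positive weight. Leaving such \<open>v\<close>
  out of the average keeps the averaging inequality and guarantees that clearing a neighbourhood
  shrinks the support. The error \<open>\<delta>\<close> occurs only on the colouring branch, of probability \<open>1 / K\<close>.\<close>

lemma attainable_demand_step:
  fixes K r :: real and w :: "'a \<Rightarrow> real"
  assumes G: "finite_simple_graph V E" and K: "1 < K" and r: "0 < r" and rK: "r * K = exp (K - 1)"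
    and q: "\<And>v. v \<in> V \<Longrightarrow> fractional_coloring r (neighbors E v) (induced_edges E (neighbors E v)) (q v)"
    and w: "\<And>v. v \<in> V \<Longrightarrow> 0 \<le> w v"
    and edge: "v0 \<in> V" "0 < w v0" "0 < sum w (neighbors E v0)"
    and clear: "\<And>v. v \<in> V \<Longrightarrow> 0 < sum w (neighbors E v) \<Longrightarrow>
      attainable V E (\<lambda>u. demand K E (reweight E (r * K) v {} w) u)"
    and color: "\<And>v S. attainable V E (\<lambda>u. demand K E (reweight E (r * K) v S w) u - \<delta>)"
  shows "attainable V E (\<lambda>u. demand K E w u - \<delta> / K)"
proof -
  have V: "finite V" using G by (simp add: finite_simple_graph_def)
  define C where "C = (\<lambda>v. independent_sets (neighbors E v) (induced_edges E (neighbors E v)))"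
  define B where "B = {v \<in> V. 0 < w v \<and> 0 < sum w (neighbors E v)}"
  define W where "W = sum w B"
  note finN = finite_neighbors[OF G] and subN = neighbors_subset[OF G]
  have B: "finite B" "B \<subseteq> V" "v0 \<in> B" using V edge by (auto simp: B_def)
  have W: "0 < W"
    unfolding W_def using B edge w by (intro sum_pos2[of B v0]) auto
  have q0: "0 \<le> q v S" and q1: "sum (q v) (C v) = 1" if "v \<in> V" for v S
    using q[OF that] by (auto simp: fractional_coloring_def C_def)
  define a where "a = (\<lambda>v u. (K - 1) / K * demand K E (reweight E (r * K) v {} w) u
      + 1 / K * (\<Sum>S\<in>C v. q v S * (demand K E (reweight E (r * K) v S w) u - \<delta>)))"
  have a: "attainable V E (a v)" if v: "v \<in> B" for v
  proof -
    have vV: "v \<in> V" using v B by auto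
    have 1: "attainable V E (\<lambda>u. \<Sum>S\<in>C v. q v S * (demand K E (reweight E (r * K) v S w) u - \<delta>))"
      using q0[OF vV] q1[OF vV] color finite_independent_sets[OF finN]
      by (intro attainable_convex_combination[OF V]) (auto simp: C_def)
    have 2: "attainable V E (\<lambda>u. demand K E (reweight E (r * K) v {} w) u)"
      using v by (intro clear) (auto simp: B_def)
    have "attainable V E (\<lambda>u. \<Sum>i\<in>{True, False}. (if i then (K - 1) / K else 1 / K) *
       (if i then demand K E (reweight E (r * K) v {} w) u
        else \<Sum>S\<in>C v. q v S * (demand K E (reweight E (r * K) v S w) u - \<delta>)))"
    proof (rule attainable_convex_combination[OF V])
      show "(\<Sum>i\<in>{True, False}. if i then (K - 1) / K else 1 / K) = 1"
        using K by (simp add: field_simps)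
      show "attainable V E (\<lambda>u. if i then demand K E (reweight E (r * K) v {} w) u
          else \<Sum>S\<in>C v. q v S * (demand K E (reweight E (r * K) v S w) u - \<delta>))" for i
        using 1 2 by (cases i) simp_all
    qed (use K in auto)
    then show ?thesis by (simp add: a_def)
  qed
  have "attainable V E (\<lambda>u. \<Sum>v\<in>B. w v / W * a v u)"
    using a W w B by (intro attainable_convex_combination[OF V])
      (auto simp: W_def[symmetric] simp flip: sum_divide_distrib)
  then show ?thesis
  proof (rule attainable_mono)
    fix u assume u: "u \<in> V"
    define g where "g = (\<lambda>v. (K - 1) * demand K E (reweight E (r * K) v {} w) u +
      (\<Sum>S\<in>C v. q v S * demand K E (reweight E (r * K) v S w) u))"
    have "w v * g v = w v * (K * demand K E w u)" if v: "v \<in> V - B" for v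
    proof (cases "w v = 0")
      case False
      then have "0 < w v" using w[of v] v by auto
      then have "sum w (neighbors E v) = 0"
        using v w subN[of v] sum_nonneg[of "neighbors E v" w] by (fastforce simp: B_def)
      then have "w z = 0" if "z \<in> neighbors E v" for z
        using that w subN[of v] finN[of v] by (subst (asm) sum_nonneg_eq_0_iff) auto
      then have "reweight E (r * K) v S w = w" for S by (auto simp: reweight_def)
      then show ?thesis using q1[of v] v by (simp add: g_def algebra_simps flip: sum_distrib_right)
    qed simp
    then have rest: "(\<Sum>v\<in>V - B. w v * g v) = sum w (V - B) * (K * demand K E w u)"
      unfolding sum_distrib_right by (intro sum.cong refl)
    have "K * sum w V * demand K E w u \<le> (\<Sum>v\<in>V. w v * g v)"
      unfolding g_def C_def by (rule demand_le_average[OF G K r rK q w u])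
    also have "\<dots> = (\<Sum>v\<in>B. w v * g v) + (\<Sum>v\<in>V - B. w v * g v)"
      using sum.subset_diff[OF B(2) V] by (simp add: add.commute)
    also have "K * sum w V * demand K E w u
        = W * (K * demand K E w u) + sum w (V - B) * (K * demand K E w u)"
      using sum.subset_diff[OF B(2) V, of w] by (simp add: W_def algebra_simps)
    finally have "W * (K * demand K E w u) \<le> (\<Sum>v\<in>B. w v * g v)" using rest by simp
    then have "demand K E w u - \<delta> / K \<le> (\<Sum>v\<in>B. w v * g v) / (W * K) - \<delta> / K"
      using W K by (simp add: field_simps)
    also have "\<dots> = (\<Sum>v\<in>B. w v / W * (g v / K - \<delta> / K))"
    proof -
      have "(\<Sum>v\<in>B. w v / W * (g v / K - \<delta> / K))
          = (\<Sum>v\<in>B. w v * g v) / (W * K) - (sum w B / W) * \<delta> / K"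
        by (simp add: right_diff_distrib sum_subtractf sum_divide_distrib sum_distrib_right)
      then show ?thesis using W by (simp add: W_def)
    qed
    also have "\<dots> = (\<Sum>v\<in>B. w v / W * a v u)"
    proof (intro sum.cong refl arg_cong2[of _ _ _ _ "(*)"])
      fix v assume "v \<in> B"
      then have "sum (q v) (C v) = 1" using q1 B by auto
      then have avg: "(\<Sum>S\<in>C v. q v S * (demand K E (reweight E (r * K) v S w) u - \<delta>))
          = (\<Sum>S\<in>C v. q v S * demand K E (reweight E (r * K) v S w) u) - \<delta>"
        by (simp add: right_diff_distrib sum_subtractf flip: sum_distrib_right)
      have "((K - 1) * P + Q) / K - \<delta> / K = (K - 1) / K * P + 1 / K * (Q - \<delta>)" for P Q
        using K by (simp add: field_simps)
      then show "g v / K - \<delta> / K = a v u" by (simp only: a_def g_def avg)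
    qed
    finally show "demand K E w u - \<delta> / K \<le> (\<Sum>v\<in>B. w v / W * a v u)" .
  qed
qed

text \<open>If no edge joins two vertices of positive weight, these vertices form an independent set, which meets
  every demand with certainty.\<close>

lemma attainable_demand_edgeless:
  assumes G: "finite_simple_graph V E" and K: "0 \<le> K"
    and w: "\<And>v. v \<in> V \<Longrightarrow> 0 \<le> w v"
    and edgeless: "\<And>v. v \<in> V \<Longrightarrow> 0 < w v \<Longrightarrow> \<not> 0 < sum w (neighbors E v)"
  shows "attainable V E (demand K E w)"
proof -
  have V: "finite V" using G by (simp add: finite_simple_graph_def)
  note finN = finite_neighbors[OF G] and subN = neighbors_subset[OF G]
  have "{v, z} \<notin> E" if v: "v \<in> V" "0 < w v" and z: "0 < w z" for v z
  proof
    assume "{v, z} \<in> E"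
    then have "z \<in> neighbors E v" by (simp add: neighbors_def)
    then have "0 < sum w (neighbors E v)"
      using z w subN[of v] finN[of v] by (intro sum_pos2[of _ z]) auto
    then show False using edgeless[OF v] by simp
  qed
  then have "{v \<in> V. 0 < w v} \<in> independent_sets V E"
    by (auto simp: independent_sets_def indep_def)
  from attainable_indicator[OF V this] show ?thesis
  proof (rule attainable_mono)
    fix u assume "u \<in> V"
    then show "demand K E w u \<le> (if u \<in> {v \<in> V. 0 < w v} then 1 else 0)"
      using demand_bounds(2)[OF K, of E u w] w subN[of u] by (cases "0 < w u") (auto simp: demand_def)
  qed
qed

text \<open>Induction on the size of the support. For supports of bounded size the colouring branch
  may keep the support unchanged, so an inner induction reduces the error by the factor \<open>1 / K\<close> in
  each round, starting from the error \<open>1\<close>, at which nothing is demanded.\<close>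

lemma attainable_demand:
  fixes K r :: real and w :: "'a \<Rightarrow> real"
  assumes G: "finite_simple_graph V E" and K: "1 < K" and r: "0 < r" and rK: "r * K = exp (K - 1)"
    and q: "\<And>v. v \<in> V \<Longrightarrow> fractional_coloring r (neighbors E v) (induced_edges E (neighbors E v)) (q v)"
    and w: "\<And>v. v \<in> V \<Longrightarrow> 0 \<le> w v"
  shows "attainable V E (demand K E w)"
  using w
proof (induction "card {v \<in> V. 0 < w v}" arbitrary: w rule: less_induct)
  case less
  have V: "finite V" using G by (simp add: finite_simple_graph_def)
  have K0: "0 \<le> K" using K by simp
  note subN = neighbors_subset[OF G]
  have rK0: "0 < r * K" using r K by simp
  have supp: "{u \<in> V. 0 < reweight E (r * K) v S x u} \<subseteq> {u \<in> V. 0 < x u}" for v S x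
  proof
    fix u assume "u \<in> {u \<in> V. 0 < reweight E (r * K) v S x u}"
    then show "u \<in> {u \<in> V. 0 < x u}"
      using zero_less_mult_pos[OF _ rK0, of "x u"]
      by (cases "u \<in> neighbors E v"; cases "u \<in> S") (simp_all add: reweight_def)
  qed
  have nn: "0 \<le> reweight E (r * K) v S x z" if "0 \<le> x z" for v S x z
    using that rK0 by (intro reweight_nonneg) auto
  have approx: "attainable V E (\<lambda>u. demand K E x u - (1 / K) ^ n)"
    if "\<And>v. v \<in> V \<Longrightarrow> 0 \<le> x v" "card {v \<in> V. 0 < x v} \<le> card {v \<in> V. 0 < w v}" for n x
    using that
  proof (induction n arbitrary: x)
    case 0
    show ?case
    proof (rule attainable_mono[OF attainable_indicator[OF V empty_independent]])
      fix u assume "u \<in> V"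
      have "demand K E x u \<le> 1"
        by (rule demand_bounds(2)[OF K0]) (use 0(1) subN in blast)
      then show "demand K E x u - (1 / K) ^ 0 \<le> (if u \<in> {} then 1 else 0)" by simp
    qed
  next
    case (Suc n)
    show ?case
    proof (cases "\<exists>v\<in>V. 0 < x v \<and> 0 < sum x (neighbors E v)")
      case True
      then obtain v0 where v0: "v0 \<in> V" "0 < x v0" "0 < sum x (neighbors E v0)" by blast
      have "attainable V E (\<lambda>u. demand K E x u - (1 / K) ^ n / K)"
      proof (rule attainable_demand_step[OF G K r rK q Suc.prems(1) v0])
        fix v assume "v \<in> V" and "0 < sum x (neighbors E v)"
        then obtain z where z: "z \<in> neighbors E v" "0 < x z"
          using sum_nonpos[of "neighbors E v" x] by (metis not_less)
        have "{u \<in> V. 0 < reweight E (r * K) v {} x u} \<subset> {u \<in> V. 0 < x u}"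
        proof (intro psubsetI supp notI)
          have "z \<in> {u \<in> V. 0 < x u}" using z subN[of v] by blast
          moreover have "reweight E (r * K) v {} x z = 0" using z by (simp add: reweight_def)
          moreover assume "{u \<in> V. 0 < reweight E (r * K) v {} x u} = {u \<in> V. 0 < x u}"
          ultimately show False by force
        qed
        then have smaller: "card {u \<in> V. 0 < reweight E (r * K) v {} x u} < card {u \<in> V. 0 < x u}"
          by (rule psubset_card_mono[rotated]) (use V in simp)
        show "attainable V E (demand K E (reweight E (r * K) v {} x))"
        proof (rule less.hyps[rotated])
          show "0 \<le> reweight E (r * K) v {} x u" if "u \<in> V" for u
            using Suc.prems(1)[OF that] by (rule nn)
        qed (use smaller Suc.prems(2) in linarith)
      next
        fix v S
        have no_larger: "card {u \<in> V. 0 < reweight E (r * K) v S x u} \<le> card {u \<in> V. 0 < x u}"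
          using V by (intro card_mono supp) simp
        show "attainable V E (\<lambda>u. demand K E (reweight E (r * K) v S x) u - (1 / K) ^ n)"
        proof (rule Suc.IH)
          show "0 \<le> reweight E (r * K) v S x u" if "u \<in> V" for u
            using Suc.prems(1)[OF that] by (rule nn)
        qed (use no_larger Suc.prems(2) in linarith)
      qed
      then show ?thesis by simp
    next
      case False
      then have "attainable V E (demand K E x)"
        using Suc.prems(1) by (intro attainable_demand_edgeless[OF G K0]) auto
      then show ?thesis by (rule attainable_mono) (use K in simp)
    qed
  qed
  show ?case
  proof (rule attainable_closed[OF V])
    fix \<epsilon> :: real assume "0 < \<epsilon>"
    then obtain n where n: "(1 / K) ^ n < \<epsilon>" using K real_arch_pow_inv[of \<epsilon> "1 / K"] by auto
    show "attainable V E (\<lambda>u. demand K E w u - \<epsilon>)"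
      by (rule attainable_mono[OF approx[OF less.prems order_refl, of n]]) (use n in auto)
  qed
qed

theorem theorem4:
  fixes r :: real and V :: "'a set" and E :: "'a set set" and w :: "'a \<Rightarrow> real"
  assumes "r \<ge> 1"
    and "finite_simple_graph V E"
    and "neighborhoods_fractionally_colorable r V E"
    and "\<forall>v\<in>V. w v > 0"
  shows "\<exists>\<mu> :: 'a set pmf. set_pmf \<mu> \<subseteq> independent_sets V E \<and>
    (\<forall>v\<in>V. occupancy \<mu> v \<ge> shearer (K_const r * weighted_degree E w v))"
proof (rule attainable_imp_pmf)
  note r = assms(1) and G = assms(2) and w = assms(4)
  show V: "finite V" using G by (simp add: finite_simple_graph_def)
  define K where "K = K_const r"
  have K: "1 \<le> K" "K - 1 = ln (r * K)"
    using theI'[OF K_const_ex1[OF r]] by (auto simp: K_def K_const_def)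
  then have rK: "r * K = exp (K - 1)" using r by simp
  have "\<forall>v\<in>V. \<exists>p. fractional_coloring r (neighbors E v) (induced_edges E (neighbors E v)) p"
    using assms(3) fractional_coloring_pmf[OF finite_neighbors[OF G]]
    unfolding neighborhoods_fractionally_colorable_def by blast
  then obtain p where p: "\<And>v. v \<in> V \<Longrightarrow>
      fractional_coloring r (neighbors E v) (induced_edges E (neighbors E v)) (p v)"
    by (auto dest!: bchoice)
  have "attainable V E (\<lambda>v. shearer (K * weighted_degree E w v))"
  proof (rule attainable_closed[OF V])
    fix \<epsilon> :: real assume \<epsilon>: "0 < \<epsilon>"
    \<comment> \<open>The slightly larger constant \<open>K'\<close> exceeds \<open>1\<close> even when \<open>r = 1\<close>. It belongs to the parameter \<open>r'\<close>,
      to which the colourings can be thinned, and it lowers the demand by at most \<open>\<epsilon>\<close>.\<close>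
    define K' where "K' = K + \<epsilon>"
    define r' where "r' = exp (K' - 1) / K'"
    have K': "1 < K'" using K \<epsilon> by (simp add: K'_def)
    have r'K': "r' * K' = exp (K' - 1)" "0 < r'" using K' by (auto simp: r'_def)
    have "r * K' \<le> r * K * (1 + \<epsilon>)"
    proof -
      have "K' \<le> K * (1 + \<epsilon>)" using K \<epsilon> by (simp add: K'_def algebra_simps)
      then show ?thesis using r by (simp add: mult.assoc)
    qed
    also have "\<dots> \<le> exp (K - 1) * exp \<epsilon>"
      unfolding rK by (intro mult_left_mono exp_ge_add_one_self) simp
    also have "\<dots> = r' * K'"
      unfolding r'K' by (simp add: K'_def flip: exp_add)
    finally have rr': "r \<le> r'" using K' by simp
    define q where "q = (\<lambda>v S. r / r' * p v S + (if S = {} then 1 - r / r' else 0))"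
    have q: "fractional_coloring r' (neighbors E v) (induced_edges E (neighbors E v)) (q v)"
      if "v \<in> V" for v
      unfolding q_def
      by (rule fractional_coloring_thin[OF finite_neighbors[OF G] p[OF that]]) (use r rr' in auto)
    have "attainable V E (demand K' E w)"
      by (rule attainable_demand[OF G K' r'K'(2,1) q]) (meson w less_imp_le)+
    then show "attainable V E (\<lambda>v. shearer (K * weighted_degree E w v) - \<epsilon>)"
    proof (rule attainable_mono)
      fix v assume v: "v \<in> V"
      define d where "d = weighted_degree E w v"
      have wv: "0 < w v" using w v by blast
      have d: "0 \<le> d"
        unfolding d_def weighted_degree_def using wv w neighbors_subset[OF G, of v]
        by (intro divide_nonneg_pos sum_nonneg) (auto simp: less_imp_le)
      have "shearer (K * d) - \<epsilon> \<le> shearer (K' * d)"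
      proof (cases "d = 0")
        case False
        then have x: "0 < K * d" using d K by simp
        have "(shearer (K * d) - shearer_slope (K * d)) * (\<epsilon> / K) \<le> 1 * \<epsilon>"
          using shearer_slope_nonneg[OF x] shearer_slope_le[OF x] shearer_le_1[of "K * d"] x K \<epsilon>
          by (intro mult_mono) (auto simp: divide_simps)
        moreover have "1 - K' * d / (K * d) = - (\<epsilon> / K)"
          using False K by (simp add: K'_def field_simps)
        ultimately show ?thesis
          using shearer_tangent[OF x, of "K' * d"] d K' by simp
      qed (use \<epsilon> in simp)
      then show "shearer (K * weighted_degree E w v) - \<epsilon> \<le> demand K' E w v"
        using wv by (simp add: demand_def d_def)
    qed
  qed
  then show "attainable V E (\<lambda>v. shearer (K_const r * weighted_degree E w v))"
    by (simp add: K_def)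
qed

end
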